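(* The parametric equations of all non-geodesic biharmonic curves (parametrized by arc length) of the Heisenberg group $(\mathbb{H}_3,g)$ are $$ \begin{cases} x(s)=\frac1A\sin\alpha_0\sin(As+a)+b,\\ y(s)=-\frac1A\sin\alpha_0\cos(As+a)+c,\\ z(s)=\Big(\cos\alpha_0+\frac{(\sin\alpha_0)^2}{2A}\Big)s-\frac{b}{2A}\sin\alpha_0\cos(As+a)-\frac{c}{2A}\sin\alpha_0\sin(As+a)+d, \end{cases} $$ where $A=\frac{\cos\alpha_0\pm\sqrt{5(\cos\alpha_0)^2-4}}{2}$ (either sign), $\alpha_0\in\big(0,\arccos\frac{2\sqrt5}{5}\big]\cup\big[\arccos\big(-\frac{2\sqrt5}{5}\big),\pi\big)$ and $a,b,c,d\in\mathbb{R}$. That is, for an open interval $I\subset\mathbb{R}$, a smooth curve $\gamma=(x,y,z):I\to\mathbb{H}_3$ parametrized by arc length is biharmonic and not a geodesic if and only if there exist $\alpha_0\in\big(0,\arccos\frac{2\sqrt5}{5}\big]\cup\big[\arccos\big(-\frac{2\sqrt5}{5}\big),\pi\big)$, a choice of sign in $A=\frac{\cos\alpha_0\pm\sqrt{5(\cos\alpha_0)^2-4}}{2}$, and $a,b,c,d\in\mathbb{R}$ for which $x(s)=\frac1A\sin\alpha_0\sin(As+a)+b$, $y(s)=-\frac1A\sin\alpha_0\cos(As+a)+c$ and $z(s)=\Big(\cos\alpha_0+\frac{(\sin\alpha_0)^2}{2A}\Big)s-\frac{b}{2A}\sin\alpha_0\cos(As+a)-\frac{c}{2A}\sin\alpha_0\sin(As+a)+d$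 for all $s\in I$.
   Context: The Heisenberg group $\mathbb{H}_3$ is $\mathbb{R}^3$ (coordinates $x,y,z$) with the multiplication $(\tilde x,\tilde y,\tilde z)(x,y,z)=(\tilde x+x,\tilde y+y,\tilde z+z+\frac12\tilde x y-\frac12\tilde y x)$ and the left-invariant Riemannian metric $g=dx^2+dy^2+(dz+\frac y2dx-\frac x2dy)^2$. $\nabla$ is the Levi-Civita connection of $g$, and the curvature sign convention is $R(X,Y)Z=-\nabla_X\nabla_YZ+\nabla_Y\nabla_XZ+\nabla_{[X,Y]}Z$. Everything is smooth ($C^\infty$). For a curve $\gamma$ parametrized by arc length with $T=\gamma'$: $\gamma$ is a geodesic if $\nabla_TT=0$ identically, and non-geodesic otherwise; $\gamma$ is biharmonic if $\tau_2(\gamma)=\nabla_T\nabla_T\nabla_TT+R(T,\nabla_TT)T=0$. *)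

theory Defs
  imports "HOL-Analysis.Analysis"
begin

section \<open>Levi-Civita connection and curvature in a global chart\<close>

text \<open>
  A metric on \<open>real ^ 'n\<close> is a function \<open>g\<close> with \<open>g p u v\<close> the inner product at the point \<open>p\<close> of the
  tangent vectors \<open>u\<close> and \<open>v\<close>, which are given by their components in the coordinate
  basis \<open>axis i 1\<close>. Vector fields are functions \<open>real ^ 'n \<Rightarrow> real ^ 'n\<close>.
\<close>

definition metric_matrix :: "(real^'n \<Rightarrow> real^'n \<Rightarrow> real^'n \<Rightarrow> real) \<Rightarrow> real^'n \<Rightarrow> real^'n^'n"
  where "metric_matrix g p = (\<chi> i j. g p (axis i 1) (axis j 1))"

definition metric_partial ::
  "(real^'n \<Rightarrow> real^'n \<Rightarrow> real^'n \<Rightarrow> real) \<Rightarrow> real^'n \<Rightarrow> 'n \<Rightarrow> 'n \<Rightarrow> 'n \<Rightarrow> real"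
  where "metric_partial g p l i j =
    frechet_derivative (\<lambda>q. metric_matrix g q $ i $ j) (at p) (axis l 1)"

definition christoffel ::
  "(real^'n \<Rightarrow> real^'n \<Rightarrow> real^'n \<Rightarrow> real) \<Rightarrow> real^'n \<Rightarrow> 'n \<Rightarrow> 'n \<Rightarrow> 'n \<Rightarrow> real"
  where "christoffel g p k i j =
    (\<Sum>l\<in>UNIV. matrix_inv (metric_matrix g p) $ k $ l *
      (metric_partial g p i j l + metric_partial g p j i l - metric_partial g p l i j)) / 2"

definition christoffel_form ::
  "(real^'n \<Rightarrow> real^'n \<Rightarrow> real^'n \<Rightarrow> real) \<Rightarrow> real^'n \<Rightarrow> real^'n \<Rightarrow> real^'n \<Rightarrow> real^'n"
  where "christoffel_form g p u v =
    (\<chi> k. \<Sum>i\<in>UNIV. \<Sum>j\<in>UNIV. christoffel g p k i j * u $ i * v $ j)"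

definition levi_civita ::
  "(real^'n \<Rightarrow> real^'n \<Rightarrow> real^'n \<Rightarrow> real) \<Rightarrow>
    (real^'n \<Rightarrow> real^'n) \<Rightarrow> (real^'n \<Rightarrow> real^'n) \<Rightarrow> real^'n \<Rightarrow> real^'n"
  where "levi_civita g X Y p =
    frechet_derivative Y (at p) (X p) + christoffel_form g p (X p) (Y p)"

definition lie_bracket ::
  "(real^'n \<Rightarrow> real^'n) \<Rightarrow> (real^'n \<Rightarrow> real^'n) \<Rightarrow> real^'n \<Rightarrow> real^'n"
  where "lie_bracket X Y p = frechet_derivative Y (at p) (X p) - frechet_derivative X (at p) (Y p)"

text \<open>The sign is opposite to the one in \<open>R(X,Y) = [\<nabla>\<^sub>X,\<nabla>\<^sub>Y] - \<nabla>\<^bsub>[X,Y]\<^esub>\<close>.\<close>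

definition curvature_field ::
  "(real^'n \<Rightarrow> real^'n \<Rightarrow> real^'n \<Rightarrow> real) \<Rightarrow>
    (real^'n \<Rightarrow> real^'n) \<Rightarrow> (real^'n \<Rightarrow> real^'n) \<Rightarrow> (real^'n \<Rightarrow> real^'n) \<Rightarrow> real^'n \<Rightarrow> real^'n"
  where "curvature_field g X Y Z p =
    - levi_civita g X (levi_civita g Y Z) p
    + levi_civita g Y (levi_civita g X Z) p
    + levi_civita g (lie_bracket X Y) Z p"

text \<open>
  The curvature is a tensor, so its value on tangent vectors at a point may be computed from any
  extension of them to vector fields; we use the fields with constant components.
\<close>

definition curvature ::
  "(real^'n \<Rightarrow> real^'n \<Rightarrow> real^'n \<Rightarrow> real) \<Rightarrow>
    real^'n \<Rightarrow> real^'n \<Rightarrow> real^'n \<Rightarrow> real^'n \<Rightarrow> real^'n"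
  where "curvature g p u v w = curvature_field g (\<lambda>_. u) (\<lambda>_. v) (\<lambda>_. w) p"


section \<open>Curves\<close>

definition smooth_curve_on :: "real set \<Rightarrow> (real \<Rightarrow> real^'n) \<Rightarrow> bool"
  where "smooth_curve_on I \<gamma> \<longleftrightarrow>
    (\<forall>n. \<forall>s\<in>I. ((\<lambda>f t. vector_derivative f (at t)) ^^ n) \<gamma> differentiable (at s))"

definition velocity :: "(real \<Rightarrow> real^'n) \<Rightarrow> real \<Rightarrow> real^'n"
  where "velocity \<gamma> s = vector_derivative \<gamma> (at s)"

definition arc_length_on ::
  "(real^'n \<Rightarrow> real^'n \<Rightarrow> real^'n \<Rightarrow> real) \<Rightarrow> real set \<Rightarrow> (real \<Rightarrow> real^'n) \<Rightarrow> bool"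
  where "arc_length_on g I \<gamma> \<longleftrightarrow> (\<forall>s\<in>I. sqrt (g (\<gamma> s) (velocity \<gamma> s) (velocity \<gamma> s)) = 1)"

definition covariant_derivative ::
  "(real^'n \<Rightarrow> real^'n \<Rightarrow> real^'n \<Rightarrow> real) \<Rightarrow> (real \<Rightarrow> real^'n) \<Rightarrow> (real \<Rightarrow> real^'n) \<Rightarrow> real \<Rightarrow> real^'n"
  where "covariant_derivative g \<gamma> V s =
    vector_derivative V (at s) + christoffel_form g (\<gamma> s) (velocity \<gamma> s) (V s)"

lemma covariant_derivative_compose:
  assumes "\<gamma> differentiable (at s)" "Y differentiable (at (\<gamma> s))" "X (\<gamma> s) = velocity \<gamma> s"
  shows "covariant_derivative g \<gamma> (Y \<circ> \<gamma>) s = levi_civita g X Y (\<gamma> s)"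
proof -
  have "(\<gamma> has_vector_derivative velocity \<gamma> s) (at s)"
    using assms(1) by (simp add: velocity_def vector_derivative_works)
  moreover have "(Y has_derivative frechet_derivative Y (at (\<gamma> s))) (at (\<gamma> s))"
    using assms(2) frechet_derivative_works by blast
  ultimately have "((Y \<circ> \<gamma>) has_vector_derivative frechet_derivative Y (at (\<gamma> s)) (velocity \<gamma> s)) (at s)"
    using vector_derivative_diff_chain_within[of \<gamma> _ s UNIV Y]
    by (metis has_derivative_at_withinI)
  then show ?thesis
    by (simp add: covariant_derivative_def levi_civita_def assms(3) vector_derivative_at)
qed

definition geodesic_on ::
  "(real^'n \<Rightarrow> real^'n \<Rightarrow> real^'n \<Rightarrow> real) \<Rightarrow> real set \<Rightarrow> (real \<Rightarrow> real^'n) \<Rightarrow> bool"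
  where "geodesic_on g I \<gamma> \<longleftrightarrow> (\<forall>s\<in>I. covariant_derivative g \<gamma> (velocity \<gamma>) s = 0)"

definition bitension ::
  "(real^'n \<Rightarrow> real^'n \<Rightarrow> real^'n \<Rightarrow> real) \<Rightarrow> (real \<Rightarrow> real^'n) \<Rightarrow> real \<Rightarrow> real^'n"
  where "bitension g \<gamma> s =
    (let D = covariant_derivative g \<gamma>; T = velocity \<gamma>
     in D (D (D T)) s + curvature g (\<gamma> s) (T s) (D T s) (T s))"

definition biharmonic_on ::
  "(real^'n \<Rightarrow> real^'n \<Rightarrow> real^'n \<Rightarrow> real) \<Rightarrow> real set \<Rightarrow> (real \<Rightarrow> real^'n) \<Rightarrow> bool"
  where "biharmonic_on g I \<gamma> \<longleftrightarrow> (\<forall>s\<in>I. bitension g \<gamma> s = 0)"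


section \<open>The Heisenberg group\<close>

definition heis_mult :: "real^3 \<Rightarrow> real^3 \<Rightarrow> real^3"
  where "heis_mult q p = vector [q $ 1 + p $ 1, q $ 2 + p $ 2,
    q $ 3 + p $ 3 + q $ 1 * p $ 2 / 2 - q $ 2 * p $ 1 / 2]"

definition heis_form :: "real^3 \<Rightarrow> real^3 \<Rightarrow> real"
  where "heis_form p u = u $ 3 + p $ 2 / 2 * u $ 1 - p $ 1 / 2 * u $ 2"

definition heis_metric :: "real^3 \<Rightarrow> real^3 \<Rightarrow> real^3 \<Rightarrow> real"
  where "heis_metric p u v = u $ 1 * v $ 1 + u $ 2 * v $ 2 + heis_form p u * heis_form p v"

lemma heis_metric_sym: "heis_metric p u v = heis_metric p v u"
  by (simp add: heis_metric_def algebra_simps)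

lemma heis_metric_bilinear: "bilinear (heis_metric p)"
  by (auto simp: bilinear_def heis_metric_def heis_form_def field_simps intro!: linearI)

lemma heis_metric_pos: "u \<noteq> 0 \<Longrightarrow> heis_metric p u u > 0"
proof -
  assume u: "u \<noteq> 0"
  have nn: "heis_metric p u u = (u$1)\<^sup>2 + (u$2)\<^sup>2 + (heis_form p u)\<^sup>2"
    by (simp add: heis_metric_def power2_eq_square)
  have "heis_metric p u u \<noteq> 0"
  proof
    assume "heis_metric p u u = 0"
    then have "(u$1)\<^sup>2 + (u$2)\<^sup>2 + (heis_form p u)\<^sup>2 = 0" using nn by simp
    then have "u$1 = 0 \<and> u$2 = 0 \<and> heis_form p u = 0"
      by (simp add: add_nonneg_eq_0_iff)
    then show False using u by (auto simp: heis_form_def vec_eq_iff forall_3)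
  qed
  then show ?thesis unfolding nn by (smt (verit) zero_le_power2)
qed

lemma heis_metric_left_invariant:
  assumes "L = frechet_derivative (heis_mult q) (at p)"
  shows "heis_metric (heis_mult q p) (L u) (L v) = heis_metric p u v"
proof -
  define M :: "real^3 \<Rightarrow> real^3"
    where "M h = vector [h $ 1, h $ 2, h $ 3 + q $ 1 * h $ 2 / 2 - q $ 2 * h $ 1 / 2]" for h
  have eq: "heis_mult q = (\<lambda>p. q + M p)"
    by (auto simp: fun_eq_iff heis_mult_def M_def vec_eq_iff forall_3)
  have "linear M"
    by (auto intro!: linearI simp: M_def vec_eq_iff forall_3 algebra_simps add_divide_distrib)
  then have "(M has_derivative M) (at p)"
    by (simp add: linear_imp_has_derivative)
  then have "((\<lambda>p. q + M p) has_derivative M) (at p)"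
    by (auto intro!: derivative_eq_intros)
  then have "L = M" unfolding assms eq by (metis frechet_derivative_at)
  moreover have "heis_form (heis_mult q p) (M h) = heis_form p h" for h
    by (simp add: M_def heis_form_def heis_mult_def algebra_simps add_divide_distrib)
  ultimately show ?thesis
    by (simp add: heis_metric_def) (simp add: M_def)
qed

text \<open>
  \<^const>\<open>levi_civita\<close> for \<^const>\<open>heis_metric\<close> is torsion-free and compatible with the metric, which
  characterises the Levi-Civita connection.
\<close>

lemma heis_form_has_derivative [derivative_intros]:
  assumes "(Y has_derivative D) (at p)" "(f has_derivative E) (at p)"
  shows "((\<lambda>q. heis_form (f q) (Y q)) has_derivative
    (\<lambda>h. heis_form (f p) (D h) + E h $ 2 / 2 * Y p $ 1 - E h $ 1 / 2 * Y p $ 2)) (at p)"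
proof -
  have *: "((\<lambda>q. Y q $ i) has_derivative (\<lambda>h. D h $ i)) (at p)"
    "((\<lambda>q. f q $ i) has_derivative (\<lambda>h. E h $ i)) (at p)" for i
    using assms by (auto intro!: bounded_linear.has_derivative[OF bounded_linear_vec_nth])
  show ?thesis
    unfolding heis_form_def
    by (auto intro!: derivative_eq_intros * simp: fun_eq_iff algebra_simps add_divide_distrib)
qed

lemma heis_metric_partial:
  "metric_partial heis_metric p l i j =
    heis_form p (axis i 1) * (axis l 1 $ 2 / 2 * axis j 1 $ 1 - axis l 1 $ 1 / 2 * axis j 1 $ 2)
    + (axis l 1 $ 2 / 2 * axis i 1 $ 1 - axis l 1 $ 1 / 2 * axis i 1 $ 2) * heis_form p (axis j 1)"
proof -
  have "((\<lambda>q. metric_matrix heis_metric q $ i $ j) has_derivative (\<lambda>h.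
      heis_form p (axis i 1) * (h $ 2 / 2 * axis j 1 $ 1 - h $ 1 / 2 * axis j 1 $ 2)
      + (h $ 2 / 2 * axis i 1 $ 1 - h $ 1 / 2 * axis i 1 $ 2) * heis_form p (axis j 1))) (at p)"
    unfolding metric_matrix_def heis_metric_def
    by (simp, (rule derivative_eq_intros refl | simp add: fun_eq_iff heis_form_def[of p 0])+)
  then show ?thesis
    unfolding metric_partial_def by (simp add: frechet_derivative_at[symmetric])
qed

lemma heis_matrix_inv:
  "matrix_inv (metric_matrix heis_metric p) =
    vector [vector [1, 0, - p $ 2 / 2], vector [0, 1, p $ 1 / 2],
      vector [- p $ 2 / 2, p $ 1 / 2, 1 + ((p $ 1)\<^sup>2 + (p $ 2)\<^sup>2) / 4]]" (is "_ = ?B")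
proof -
  let ?G = "metric_matrix heis_metric p"
  have "?G ** ?B = mat 1" "?B ** ?G = mat 1"
    by (auto simp: vec_eq_iff forall_3 matrix_matrix_mult_def sum_3 mat_def metric_matrix_def
        heis_metric_def heis_form_def axis_def power2_eq_square field_simps)
  moreover have "C = ?B" if "?G ** C = mat 1" for C
  proof -
    have "C = (?B ** ?G) ** C" using \<open>?B ** ?G = mat 1\<close> by simp
    also have "\<dots> = ?B" using that by (simp add: matrix_mul_assoc[symmetric])
    finally show ?thesis .
  qed
  ultimately show ?thesis
    unfolding matrix_inv_def by (intro some_equality conjI) blast+
qed

lemma heis_christoffel_form:
  "christoffel_form heis_metric p u v =
    (let a = (v $ 2 * heis_form p u + u $ 2 * heis_form p v) / 2;
         b = - (v $ 1 * heis_form p u + u $ 1 * heis_form p v) / 2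
     in vector [a, b, p $ 1 / 2 * b - p $ 2 / 2 * a])"
  by (simp add: Let_def christoffel_form_def christoffel_def heis_matrix_inv heis_metric_partial
      vec_eq_iff forall_3 sum_3 axis_def heis_form_def)
    (simp add: power2_eq_square algebra_simps add_divide_distrib diff_divide_distrib)

lemma heis_levi_civita_torsion_free:
  "levi_civita heis_metric X Y p - levi_civita heis_metric Y X p = lie_bracket X Y p"
proof -
  have "christoffel_form heis_metric p (X p) (Y p) = christoffel_form heis_metric p (Y p) (X p)"
    by (simp add: heis_christoffel_form add.commute)
  then show ?thesis by (simp add: levi_civita_def lie_bracket_def)
qed

lemma heis_levi_civita_metric:
  assumes "Y differentiable (at p)" "Z differentiable (at p)"
  shows "frechet_derivative (\<lambda>q. heis_metric q (Y q) (Z q)) (at p) (X p) =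
    heis_metric p (levi_civita heis_metric X Y p) (Z p)
    + heis_metric p (Y p) (levi_civita heis_metric X Z p)"
proof -
  define DY where "DY = frechet_derivative Y (at p)"
  define DZ where "DZ = frechet_derivative Z (at p)"
  have D: "(Y has_derivative DY) (at p)" "(Z has_derivative DZ) (at p)"
    using assms frechet_derivative_works unfolding DY_def DZ_def by blast+
  then have N: "((\<lambda>q. Y q $ i) has_derivative (\<lambda>h. DY h $ i)) (at p)"
    "((\<lambda>q. Z q $ i) has_derivative (\<lambda>h. DZ h $ i)) (at p)" for i
    by (auto intro!: bounded_linear.has_derivative[OF bounded_linear_vec_nth])
  have "((\<lambda>q. heis_metric q (Y q) (Z q)) has_derivative (\<lambda>h.
      DY h $ 1 * Z p $ 1 + Y p $ 1 * DZ h $ 1 + DY h $ 2 * Z p $ 2 + Y p $ 2 * DZ h $ 2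
      + (heis_form p (DY h) + h $ 2 / 2 * Y p $ 1 - h $ 1 / 2 * Y p $ 2) * heis_form p (Z p)
      + heis_form p (Y p) * (heis_form p (DZ h) + h $ 2 / 2 * Z p $ 1 - h $ 1 / 2 * Z p $ 2))) (at p)"
    unfolding heis_metric_def
    by (rule derivative_eq_intros D N refl | simp add: fun_eq_iff algebra_simps)+
  then have "frechet_derivative (\<lambda>q. heis_metric q (Y q) (Z q)) (at p) (X p) =
      DY (X p) $ 1 * Z p $ 1 + Y p $ 1 * DZ (X p) $ 1 + DY (X p) $ 2 * Z p $ 2 + Y p $ 2 * DZ (X p) $ 2
      + (heis_form p (DY (X p)) + X p $ 2 / 2 * Y p $ 1 - X p $ 1 / 2 * Y p $ 2) * heis_form p (Z p)
      + heis_form p (Y p) * (heis_form p (DZ (X p)) + X p $ 2 / 2 * Z p $ 1 - X p $ 1 / 2 * Z p $ 2)"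
    by (simp add: frechet_derivative_at[symmetric])
  then show ?thesis
    by (simp add: levi_civita_def DY_def[symmetric] DZ_def[symmetric] heis_christoffel_form Let_def
        heis_metric_def heis_form_def field_simps)
qed

end

theory Submission
  imports Defs
begin

text \<open>
  In the left-invariant orthonormal frame \<open>e\<^sub>1 = \<partial>\<^sub>x - y/2 \<partial>\<^sub>z\<close>, \<open>e\<^sub>2 = \<partial>\<^sub>y + x/2 \<partial>\<^sub>z\<close>, \<open>e\<^sub>3 = \<partial>\<^sub>z\<close> the covariant
  derivative along a curve with velocity \<open>u\<close> is \<open>f \<mapsto> f' + \<omega> \<times> f\<close> with \<open>\<omega> = (u\<^sub>1, u\<^sub>2, -u\<^sub>3)/2\<close>, so that it
  satisfies the product rule for inner and cross products. Put \<open>w = \<nabla>u\<close>, \<open>w\<^sub>2 = \<nabla>w\<close>, and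
  \<open>k = \<bar>w\<bar>\<^sup>2\<close>, \<open>b = (u \<times> w)\<^sub>3\<close>, \<open>r = w\<^sub>3\<close>, \<open>t = w\<^sub>2 \<bullet> (u \<times> w)\<close>. The components of the biharmonic equation
  along \<open>u\<close>, \<open>w\<close> and \<open>u \<times> w\<close> say that \<open>k\<close> is constant, that \<open>t\<^sup>2/k + k\<^sup>2 = k/4 - b\<^sup>2\<close>, and that \<open>t' = -b r\<close>, while
  \<open>b' = r (1/2 - t/k)\<close> in any case. Differentiating the second relation gives \<open>b r (4 t - k) = 0\<close>.
  If \<open>b r \<noteq> 0\<close> at a point, then \<open>t\<close> is constant nearby and \<open>b r = -t' = 0\<close>; so \<open>b r\<close> vanishes.
  If \<open>r \<noteq> 0\<close> at a point, then \<open>b = 0\<close> nearby, so \<open>t = k/2\<close> and the second relation forces \<open>k = 0\<close>.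
  Hence \<open>r = u\<^sub>3' = 0\<close>, the pair \<open>(u\<^sub>1, u\<^sub>2)\<close> rotates with a constant speed \<open>A\<close>, and the remaining
  relation is the quadratic equation \<open>A\<^sup>2 - A cos \<alpha> + sin\<^sup>2 \<alpha> = 0\<close>.
\<close>

unbundle cross3_syntax

section \<open>The left-invariant frame\<close>

text \<open>The coordinates of the tangent vector at \<open>p\<close> whose components in the
  orthonormal frame are \<open>f\<close>.\<close>

definition unframe :: "real^3 \<Rightarrow> real^3 \<Rightarrow> real^3"
  where "unframe p f = vector [f$1, f$2, f$3 - p$2/2 * f$1 + p$1/2 * f$2]"

text \<open>Metric compatibility makes the connection matrix skew in an orthonormal frame, hence a
  cross product; left invariance frees it from the base point.\<close>

definition frame_conn :: "real^3 \<Rightarrow> real^3 \<Rightarrow> real^3"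
  where "frame_conn u f = vector [u$1/2, u$2/2, - u$3/2] \<times> f"

text \<open>
  The curvature operator on bivectors is \<open>1/4\<close> times the identity minus the orthogonal projection to
  \<open>e\<^sub>1 \<and> e\<^sub>2\<close>.
\<close>

definition frame_curv :: "real^3 \<Rightarrow> real^3 \<Rightarrow> real^3 \<Rightarrow> real^3"
  where "frame_curv x y z =
    (1/4) *\<^sub>R ((x \<bullet> z) *\<^sub>R y - (y \<bullet> z) *\<^sub>R x) - (x \<times> y) $ 3 *\<^sub>R (axis 3 1 \<times> z)"

lemma unframe_nth [simp]:
  "unframe p f $ 1 = f$1" "unframe p f $ 2 = f$2" "unframe p f $ 3 = f$3 - p$2/2 * f$1 + p$1/2 * f$2"
  by (simp_all add: unframe_def)

lemma heis_form_unframe [simp]: "heis_form p (unframe p f) = f $ 3"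
  by (simp add: heis_form_def)

lemma unframe_add: "unframe p (f + g) = unframe p f + unframe p g"
  by (simp add: vec_eq_iff forall_3 algebra_simps)

lemma unframe_eq_0_iff [simp]: "unframe p f = 0 \<longleftrightarrow> f = 0"
  by (auto simp: vec_eq_iff forall_3)

lemma inner_3: "x \<bullet> (y::real^3) = x$1 * y$1 + x$2 * y$2 + x$3 * y$3"
  by (simp add: inner_vec_def sum_3)

lemma heis_metric_unframe [simp]: "heis_metric p (unframe p f) (unframe p g) = f \<bullet> g"
  by (simp add: heis_metric_def inner_3)

section \<open>Connection and curvature in frame components\<close>

lemma has_derivative_vec3:
  fixes f :: "'a::real_normed_vector \<Rightarrow> real^3"
  assumes "((\<lambda>t. f t $ 1) has_derivative (\<lambda>h. f' h $ 1)) (at x within S)"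
    and "((\<lambda>t. f t $ 2) has_derivative (\<lambda>h. f' h $ 2)) (at x within S)"
    and "((\<lambda>t. f t $ 3) has_derivative (\<lambda>h. f' h $ 3)) (at x within S)"
  shows "(f has_derivative f') (at x within S)"
proof -
  have "((\<lambda>t. f t $ i) has_derivative (\<lambda>h. f' h $ i)) (at x within S)" for i
    using assms exhaust_3[of i] by auto
  then show ?thesis
    by (subst has_derivative_componentwise_within) (auto simp: Basis_vec_def inner_axis)
qed

lemma has_vector_derivative_vec3:
  fixes f :: "real \<Rightarrow> real^3"
  assumes "((\<lambda>t. f t $ 1) has_real_derivative f' $ 1) (at x within S)"
    and "((\<lambda>t. f t $ 2) has_real_derivative f' $ 2) (at x within S)"
    and "((\<lambda>t. f t $ 3) has_real_derivative f' $ 3) (at x within S)"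
  shows "(f has_vector_derivative f') (at x within S)"
  using assms unfolding has_vector_derivative_def
  by (intro has_derivative_vec3) (auto simp: has_field_derivative_def mult_commute_abs)

lemma has_real_derivative_nth:
  fixes f :: "real \<Rightarrow> real^'n"
  assumes "(f has_vector_derivative f') (at s)"
  shows "((\<lambda>t. f t $ i) has_real_derivative f' $ i) (at s)"
  using bounded_linear.has_vector_derivative[OF bounded_linear_vec_nth assms, of i]
  by (simp add: has_real_derivative_iff_has_vector_derivative)

text \<open>\<open>V\<close> is tied to \<open>f\<close> only on the open set \<open>I\<close>,
  since iterated covariant derivatives along \<open>\<gamma>\<close> are known only there.\<close>

lemma covariant_derivative_unframe:
  assumes "open I" "s \<in> I" "\<And>t. t \<in> I \<Longrightarrow> V t = unframe (\<gamma> t) (f t)"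
    and g: "(\<gamma> has_vector_derivative unframe (\<gamma> s) u) (at s)"
    and f: "(f has_vector_derivative f') (at s)"
  shows "covariant_derivative heis_metric \<gamma> V s = unframe (\<gamma> s) (f' + frame_conn u (f s))"
proof -
  \<comment> \<open>The added vector comes from the motion of the base point of
    \<open>unframe\<close>; the Christoffel form completes it to \<open>frame_conn\<close>.\<close>
  define V' where "V' = unframe (\<gamma> s) f' + vector [0, 0, u$1/2 * f s $ 2 - u$2/2 * f s $ 1]"
  note d = has_real_derivative_nth[OF g] has_real_derivative_nth[OF f]
  have "((\<lambda>t. unframe (\<gamma> t) (f t)) has_vector_derivative V') (at s)"
    by (rule has_vector_derivative_vec3)
      (auto simp: V'_def field_simps intro!: derivative_eq_intros d)
  then have "(V has_vector_derivative V') (at s)"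
    by (rule has_vector_derivative_transform_within_open[OF _ assms(1,2)]) (simp add: assms(3))
  then have "vector_derivative V (at s) = V'"
    by (rule vector_derivative_at)
  moreover have "velocity \<gamma> s = unframe (\<gamma> s) u"
    using g by (simp add: velocity_def vector_derivative_at)
  moreover have "V s = unframe (\<gamma> s) (f s)"
    using assms(2,3) by simp
  ultimately have "covariant_derivative heis_metric \<gamma> V s =
      V' + christoffel_form heis_metric (\<gamma> s) (unframe (\<gamma> s) u) (unframe (\<gamma> s) (f s))"
    by (simp add: covariant_derivative_def)
  also have "\<dots> = unframe (\<gamma> s) (f' + frame_conn u (f s))"
    by (simp add: heis_christoffel_form Let_def V'_def vec_eq_iff forall_3 frame_conn_def
        cross3_def field_simps)
  finally show ?thesis .
qed

text \<open>The curvature of constant fields differentiates the Christoffel form in its base point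
  only. Here \<open>c\<close>, \<open>d\<close> are its first two components at \<open>p\<close>,
  and \<open>a\<close>, \<open>b\<close> are their derivatives.\<close>

lemma frechet_christoffel_form:
  "((\<lambda>q. christoffel_form heis_metric q v w) has_derivative
     (\<lambda>h. let a = (v$2 * w$1 + w$2 * v$1) * h$2/4 - w$2 * v$2 * h$1/2;
              b = (v$1 * w$2 + w$1 * v$2) * h$1/4 - w$1 * v$1 * h$2/2;
              c = (w $ 2 * heis_form p v + v $ 2 * heis_form p w) / 2;
              d = - (w $ 1 * heis_form p v + v $ 1 * heis_form p w) / 2
     in vector [a, b, p$1/2 * b - p$2/2 * a + h$1/2 * d - h$2/2 * c])) (at p)"
proof -
  have n: "((\<lambda>q::real^3. q $ i) has_derivative (\<lambda>h. h $ i)) (at p)" for i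
    by (auto intro!: bounded_linear.has_derivative[OF bounded_linear_vec_nth])
  show ?thesis
    unfolding heis_christoffel_form Let_def heis_form_def
    by (rule has_derivative_vec3)
      (auto intro!: derivative_eq_intros n simp: fun_eq_iff field_simps)
qed

lemma heis_curvature_unframe:
  "curvature heis_metric p (unframe p x) (unframe p y) (unframe p z) = unframe p (frame_curv x y z)"
proof -
  \<comment> \<open>Constant fields commute and their covariant derivatives are values of the
    Christoffel form, so the claim becomes a polynomial identity in \<open>p\<close> and the frame
    components.\<close>
  have lc: "levi_civita heis_metric (\<lambda>_. v) (\<lambda>_. w) = (\<lambda>q. christoffel_form heis_metric q v w)" for v w
    by (simp add: fun_eq_iff levi_civita_def frechet_derivative_const)
  have lb: "lie_bracket (\<lambda>_. v) (\<lambda>_. w) = (\<lambda>_. 0)" for v w :: "real^3"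
    by (simp add: fun_eq_iff lie_bracket_def frechet_derivative_const)
  show ?thesis
    unfolding curvature_def curvature_field_def lc lb
    unfolding levi_civita_def frechet_derivative_at[OF frechet_christoffel_form, symmetric] Let_def
    by (simp add: heis_christoffel_form Let_def frame_curv_def vec_eq_iff forall_3 inner_3
       cross3_def axis_def heis_form_def) (simp add: field_simps)
qed

section \<open>Product rules for the covariant derivative\<close>

lemma frame_conn_skew: "frame_conn u f \<bullet> g = - (f \<bullet> frame_conn u g)"
  by (simp add: frame_conn_def cross3_simps)

text \<open>This is the Jacobi identity, as \<open>frame_conn u\<close> is the cross product with a
  fixed vector.\<close>

lemma frame_conn_cross:
  "frame_conn u (f \<times> g) = frame_conn u f \<times> g + f \<times> frame_conn u g"
  by (simp add: frame_conn_def cross3_simps forall_3)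

lemma frame_conn_nth3: "frame_conn u f $ 3 = (u \<times> f) $ 3 / 2"
  by (simp add: frame_conn_def cross3_simps)

text \<open>\<open>f'\<close> is the covariant derivative of \<open>f\<close> along a curve with velocity \<open>u\<close>, all in frame components.\<close>

definition frame_deriv :: "(real \<Rightarrow> real^3) \<Rightarrow> (real \<Rightarrow> real^3) \<Rightarrow> real^3 \<Rightarrow> real \<Rightarrow> bool"
  where "frame_deriv u f f' s \<longleftrightarrow> (f has_vector_derivative f' - frame_conn (u s) (f s)) (at s)"

lemma frame_deriv_inner:
  assumes "frame_deriv u f f' s" "frame_deriv u g g' s"
  shows "((\<lambda>t. f t \<bullet> g t) has_real_derivative f' \<bullet> g s + f s \<bullet> g') (at s)"
  using bounded_bilinear.has_vector_derivative[OF bounded_bilinear_inner assms[unfolded frame_deriv_def]]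
  by (simp add: has_real_derivative_iff_has_vector_derivative inner_diff_left inner_diff_right
      frame_conn_skew add.commute)

lemma frame_deriv_cross:
  assumes "frame_deriv u f f' s" "frame_deriv u g g' s"
  shows "frame_deriv u (\<lambda>t. f t \<times> g t) (f' \<times> g s + f s \<times> g') s"
proof -
  have "bounded_bilinear (\<times>)"
    using bilinear_cross bilinear_conv_bounded_bilinear by blast
  from bounded_bilinear.has_vector_derivative[OF this assms[unfolded frame_deriv_def]]
  show ?thesis
    by (simp add: frame_deriv_def frame_conn_cross Cross3.left_diff_distrib
      Cross3.right_diff_distrib algebra_simps)
qed

text \<open>The frame field \<open>e\<^sub>3\<close> is not parallel, which accounts for the
  correction term.\<close>

lemma frame_deriv_nth3:
  assumes "frame_deriv u f f' s"
  shows "((\<lambda>t. f t $ 3) has_real_derivative f' $ 3 - (u s \<times> f s) $ 3 / 2) (at s)"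
  using has_real_derivative_nth[OF assms[unfolded frame_deriv_def], of 3]
  by (simp add: frame_conn_nth3)

lemma const_if_derivative_0:
  fixes f :: "real \<Rightarrow> real"
  assumes "is_interval I" "\<And>s. s \<in> I \<Longrightarrow> (f has_real_derivative 0) (at s)" "s \<in> I" "t \<in> I"
  shows "f s = f t"
proof -
  have "convex I" using assms(1) is_interval_convex by blast
  then have "\<exists>c. \<forall>x\<in>I. f x = c"
    by (rule has_field_derivative_zero_constant) (use assms(2) DERIV_subset in blast)
  then show ?thesis using assms(3,4) by metis
qed

text \<open>Lets an identity that holds on an open set be differentiated; the relations among the
  invariants below arise from one another in this way.\<close>

lemma derivative_of_const_on_open:
  fixes f :: "real \<Rightarrow> real"
  assumes "open I" "s \<in> I" "\<And>t. t \<in> I \<Longrightarrow> f t = c" "(f has_real_derivative d) (at s)"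
  shows "d = 0"
proof -
  have "((\<lambda>_. c) has_real_derivative d) (at s)"
    using has_field_derivative_transform_within_open[OF assms(4,1,2), of "\<lambda>_. c"] assms(3) by simp
  then show ?thesis using DERIV_unique DERIV_const by blast
qed

section \<open>Biharmonic curves in frame components\<close>

text \<open>For \<open>w \<noteq> 0\<close> the vectors \<open>u\<close>, \<open>w\<close>,
  \<open>u \<times> w\<close> form an orthogonal basis, so these products capture the whole
  curvature term of the bitension.\<close>

lemma frame_curv_inner:
  assumes "u \<bullet> u = 1" "u \<bullet> w = 0"
  shows "frame_curv u w u \<bullet> u = 0"
    and "frame_curv u w u \<bullet> w = (w \<bullet> w) / 4 - ((u \<times> w) $ 3)\<^sup>2"
    and "frame_curv u w u \<bullet> (u \<times> w) = (u \<times> w) $ 3 * w $ 3"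
proof -
  have *: "frame_curv u w u = (1/4) *\<^sub>R w - (u \<times> w) $ 3 *\<^sub>R (axis 3 1 \<times> u)"
    using assms by (simp add: frame_curv_def inner_commute)
  show "frame_curv u w u \<bullet> u = 0"
    by (simp add: * inner_diff_left dot_cross_self inner_commute[of w] assms)
  have "(axis 3 1 \<times> u) \<bullet> w = (u \<times> w) $ 3"
    by (simp add: cross3_simps axis_def)
  then show "frame_curv u w u \<bullet> w = (w \<bullet> w) / 4 - ((u \<times> w) $ 3)\<^sup>2"
    by (simp add: * inner_diff_left power2_eq_square)
  \<comment> \<open>The Binet-Cauchy identity for the inner product of two cross products.\<close>
  have "(axis 3 1 \<times> u) \<bullet> (u \<times> w) = u$3 * (u \<bullet> w) - w$3 * (u \<bullet> u)"
    by (simp add: cross3_simps axis_def)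
  then show "frame_curv u w u \<bullet> (u \<times> w) = (u \<times> w) $ 3 * w $ 3"
    by (simp add: * inner_diff_left dot_cross_self assms)
qed

text \<open>The conclusions prepare the explicit solution: the first, third and fourth determine the
  shape of \<open>w\<close>, and the second then fixes the rotation speed.\<close>

lemma frame_biharmonic_invariants:
  assumes I: "open I" "is_interval I"
    and d1: "\<And>s. s \<in> I \<Longrightarrow> frame_deriv u u (w s) s"
    and d2: "\<And>s. s \<in> I \<Longrightarrow> frame_deriv u w (w2 s) s"
    and d3: "\<And>s. s \<in> I \<Longrightarrow> frame_deriv u w2 (w3 s) s"
    and unit: "\<And>s. s \<in> I \<Longrightarrow> u s \<bullet> u s = 1"
    and bi: "\<And>s. s \<in> I \<Longrightarrow> w3 s + frame_curv (u s) (w s) (u s) = 0"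
    and ng: "s0 \<in> I" "w s0 \<noteq> 0"
    and s: "s \<in> I"
  shows "w s $ 3 = 0" "w2 s \<bullet> w2 s = (w s \<bullet> w s) / 4 - ((u s \<times> w s) $ 3)\<^sup>2"
    "u s \<bullet> w s = 0" "(u s \<times> w s) $ 3 = (u s0 \<times> w s0) $ 3"
proof -
  define k where "k = w s0 \<bullet> w s0"
  define r where "r s = w s $ 3" for s
  define b where "b s = (u s \<times> w s) $ 3" for s
  define t where "t s = w2 s \<bullet> (u s \<times> w s)" for s
  have k0: "k > 0" using ng by (simp add: k_def)
  have bi': "w3 s = - frame_curv (u s) (w s) (u s)" if "s \<in> I" for s
    using bi[OF that] by (simp add: add_eq_0_iff2)
  have uw: "u s \<bullet> w s = 0" if "s \<in> I" for s
    using derivative_of_const_on_open[OF I(1) that unit frame_deriv_inner[OF d1 d1]] that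
    by (simp add: inner_commute)
  note curv = frame_curv_inner[OF unit uw]
  have uw2: "u s \<bullet> w2 s = - (w s \<bullet> w s)" if "s \<in> I" for s
    using derivative_of_const_on_open[OF I(1) that uw frame_deriv_inner[OF d1 d2]] that
    by simp
  \<comment> \<open>Differentiating \<open>u \<bullet> w2 + w \<bullet> w = 0\<close> gives
    \<open>3 * (w \<bullet> w2) + u \<bullet> w3 = 0\<close>, and \<open>u \<bullet> w3 = 0\<close>
    because the curvature term is orthogonal to \<open>u\<close>.\<close>
  have ww2: "w s \<bullet> w2 s = 0" if "s \<in> I" for s
  proof -
    have "((\<lambda>s. u s \<bullet> w2 s + w s \<bullet> w s) has_real_derivative
        (w s \<bullet> w2 s + u s \<bullet> w3 s) + (w2 s \<bullet> w s + w s \<bullet> w2 s)) (at s)"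
      using DERIV_add[OF frame_deriv_inner[OF d1 d3] frame_deriv_inner[OF d2 d2]] that by simp
    from derivative_of_const_on_open[OF I(1) that _ this, of 0]
    have "(w s \<bullet> w2 s + u s \<bullet> w3 s) + (w2 s \<bullet> w s + w s \<bullet> w2 s) = 0" using uw2 by simp
    then show ?thesis using curv(1)[OF that that] that
      by (simp add: bi' inner_commute)
  qed
  have ww: "w s \<bullet> w s = k" if "s \<in> I" for s
    unfolding k_def
    by (rule const_if_derivative_0[OF I(2) _ that ng(1)])
      (use frame_deriv_inner[OF d2 d2] ww2 in \<open>fastforce simp: inner_commute\<close>)
  \<comment> \<open>The derivative of \<open>w \<bullet> w2 = 0\<close>, with \<open>w3\<close>
    replaced by the curvature term.\<close>
  have w2w2: "w2 s \<bullet> w2 s = k / 4 - (b s)\<^sup>2" if "s \<in> I" for s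
    using derivative_of_const_on_open[OF I(1) that ww2 frame_deriv_inner[OF d2 d3]] that
      curv(2)[OF that that] bi'[OF that] ww[OF that]
    by (simp add: b_def inner_commute)
  have t2: "(t s)\<^sup>2 / k + k\<^sup>2 = k / 4 - (b s)\<^sup>2" if "s \<in> I" for s
  proof -
    \<comment> \<open>The square of the triple product is the Gram determinant of \<open>u\<close>,
      \<open>w\<close>, \<open>w2\<close>.\<close>
    have "(w2 s \<bullet> (u s \<times> w s))\<^sup>2 =
       (w2 s \<bullet> w2 s) * ((u s \<bullet> u s) * (w s \<bullet> w s) - (u s \<bullet> w s)\<^sup>2)
       - (u s \<bullet> w2 s)\<^sup>2 * (w s \<bullet> w s) - (w s \<bullet> w2 s)\<^sup>2 * (u s \<bullet> u s)
       + 2 * (u s \<bullet> w s) * (u s \<bullet> w2 s) * (w s \<bullet> w2 s)"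
      by (simp add: cross3_simps power2_eq_square)
    then have "(t s)\<^sup>2 = (k / 4 - (b s)\<^sup>2) * k - k\<^sup>2 * k"
      using that by (simp add: t_def unit uw uw2 ww ww2 w2w2)
    then show ?thesis using k0 by (simp add: field_simps power2_eq_square)
  qed
  have J: "frame_deriv u (\<lambda>t. u t \<times> w t) (u s \<times> w2 s) s" if "s \<in> I" for s
    using frame_deriv_cross[OF d1 d2] that by fastforce
  \<comment> \<open>The other term of the product rule, \<open>w2 \<bullet> (u \<times> w2)\<close>,
    vanishes.\<close>
  have dt: "(t has_real_derivative - (b s * r s)) (at s)" if "s \<in> I" for s
    using frame_deriv_inner[OF d3[OF that] J[OF that]] curv(3)[OF that that]
    by (simp add: t_def[abs_def] bi' that b_def r_def) (simp add: cross3_simps)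
  have db: "(b has_real_derivative r s * (1/2 - t s / k)) (at s)" if "s \<in> I" for s
  proof -
    \<comment> \<open>Both sides expand \<open>u \<times> (w \<times> (w2 \<times> w))\<close>. With
      \<open>u \<bullet> w = 0\<close> and \<open>w \<bullet> w2 = 0\<close> this makes
      \<open>u \<times> w2\<close> a multiple of \<open>w\<close>.\<close>
    have "(w s \<bullet> w s) *\<^sub>R (u s \<times> w2 s) - (w2 s \<bullet> w s) *\<^sub>R (u s \<times> w s) =
        (u s \<bullet> w s) *\<^sub>R (w s \<times> w2 s) - (w2 s \<bullet> (u s \<times> w s)) *\<^sub>R w s"
      by (simp add: cross3_simps forall_3)
    then have "k *\<^sub>R (u s \<times> w2 s) = - t s *\<^sub>R w s"
      using that by (simp add: ww ww2 uw t_def inner_commute)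
    then have "k * (u s \<times> w2 s) $ 3 = - t s * r s"
      by (metis r_def vector_scaleR_component real_scaleR_def)
    then have 1: "(u s \<times> w2 s) $ 3 = - t s * r s / k" using k0 by (simp add: field_simps)
    have "u s \<times> (u s \<times> w s) = (u s \<bullet> w s) *\<^sub>R u s - (u s \<bullet> u s) *\<^sub>R w s"
      by (simp add: cross3_simps forall_3)
    then have 2: "(u s \<times> (u s \<times> w s)) $ 3 = - r s" using that by (simp add: uw unit r_def)
    show ?thesis using frame_deriv_nth3[OF J[OF that]]
      by (simp add: 1 2 b_def[abs_def] algebra_simps)
  qed
  have prod: "b s * r s * (4 * t s - k) = 0" if "s \<in> I" for s
  proof -
    \<comment> \<open>The derivative of the relation \<open>t2\<close>; its terms combine to
      \<open>b * r * (1 - 4 * t / k)\<close>.\<close>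
    have "((\<lambda>s. (t s)\<^sup>2 / k + k\<^sup>2 - k / 4 + (b s)\<^sup>2) has_real_derivative
       2 * t s * (- (b s * r s)) / k + 2 * b s * (r s * (1/2 - t s / k))) (at s)"
      using k0 by (auto intro!: derivative_eq_intros dt db that)
    from derivative_of_const_on_open[OF I(1) that _ this, of 0]
    have "2 * t s * (- (b s * r s)) / k + 2 * b s * (r s * (1/2 - t s / k)) = 0" using t2 by simp
    then show ?thesis using k0 by (auto simp: field_simps)
  qed
  have cont: "continuous_on I b" "continuous_on I r"
  proof -
    show "continuous_on I b" using db DERIV_isCont continuous_at_imp_continuous_on by blast
    show "continuous_on I r" unfolding r_def
      using has_real_derivative_nth[OF d2[unfolded frame_deriv_def]] DERIV_isCont
        continuous_at_imp_continuous_on by blast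
  qed
  have br: "b s * r s = 0" if "s \<in> I" for s
  proof (rule ccontr)
    assume "b s * r s \<noteq> 0"
    define U where "U = I \<inter> (\<lambda>s. b s * r s) -` (- {0})"
    have "open U" unfolding U_def using I(1) cont
      by (intro continuous_open_preimage continuous_intros) auto
    moreover have "s \<in> U" using that \<open>b s * r s \<noteq> 0\<close> by (simp add: U_def)
    moreover have "t x = k / 4" if "x \<in> U" for x using that prod[of x] by (auto simp: U_def)
    ultimately have "- (b s * r s) = 0" using dt[OF that] derivative_of_const_on_open by blast
    then show False using \<open>b s * r s \<noteq> 0\<close> by simp
  qed
  have r0: "r s = 0" if s: "s \<in> I" for s
  proof (rule ccontr)
    assume "r s \<noteq> 0"
    define U where "U = I \<inter> r -` (- {0})"
    have U: "open U" unfolding U_def using I(1) cont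
      by (intro continuous_open_preimage continuous_intros) auto
    have sU: "s \<in> U" using s \<open>r s \<noteq> 0\<close> by (simp add: U_def)
    have b0: "b x = 0" if "x \<in> U" for x using that br[of x] by (auto simp: U_def)
    have "r s * (1/2 - t s / k) = 0"
      using derivative_of_const_on_open[OF U sU b0 db[OF s]] by simp
    then have "t s = k / 2" using \<open>r s \<noteq> 0\<close> k0 by (simp add: field_simps)
    \<comment> \<open>The term \<open>t\<^sup>2 / k\<close> uses up all of \<open>k / 4\<close>, so
      with \<open>b = 0\<close> nothing is left for \<open>k\<^sup>2\<close>.\<close>
    then have "(t s)\<^sup>2 / k = k / 4" unfolding \<open>t s = k / 2\<close> by (simp add: power2_eq_square)
    then have "k\<^sup>2 = 0" using t2[OF s] b0[OF sU] by simp
    then show False using k0 by simp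
  qed
  show "w s $ 3 = 0" using r0[OF s] by (simp add: r_def)
  show "w2 s \<bullet> w2 s = (w s \<bullet> w s) / 4 - ((u s \<times> w s) $ 3)\<^sup>2"
    using w2w2[OF s] ww[OF s] by (simp add: b_def)
  show "u s \<bullet> w s = 0" by (rule uw[OF s])
  have "b s = b s0"
    by (rule const_if_derivative_0[OF I(2) _ s ng(1)]) (use db r0 in fastforce)
  then show "(u s \<times> w s) $ 3 = (u s0 \<times> w s0) $ 3" by (simp add: b_def)
qed

section \<open>Rotation of the horizontal velocity\<close>

lemma frame_deriv_self_components:
  assumes "frame_deriv u u w s"
  shows "((\<lambda>t. u t $ 1) has_real_derivative w $ 1 - u s $ 2 * u s $ 3) (at s)"
    and "((\<lambda>t. u t $ 2) has_real_derivative w $ 2 + u s $ 1 * u s $ 3) (at s)"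
    and "((\<lambda>t. u t $ 3) has_real_derivative w $ 3) (at s)"
  using has_real_derivative_nth[OF assms[unfolded frame_deriv_def], of 1]
    has_real_derivative_nth[OF assms[unfolded frame_deriv_def], of 2]
    has_real_derivative_nth[OF assms[unfolded frame_deriv_def], of 3]
  by (simp_all add: frame_conn_def cross3_simps)

text \<open>Here \<open>c\<close> is the cosine of the angle with \<open>e\<^sub>3\<close>, and the
  equation for \<open>A\<close> is \<open>A\<^sup>2 - A * c + (1 - c\<^sup>2) = 0\<close> with the
  square completed, from which both roots can be read off.\<close>

lemma frame_biharmonic_imp_helix:
  assumes I: "open I" "is_interval I"
    and d1: "\<And>s. s \<in> I \<Longrightarrow> frame_deriv u u (w s) s"
    and d2: "\<And>s. s \<in> I \<Longrightarrow> frame_deriv u w (w2 s) s"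
    and d3: "\<And>s. s \<in> I \<Longrightarrow> frame_deriv u w2 (w3 s) s"
    and unit: "\<And>s. s \<in> I \<Longrightarrow> u s \<bullet> u s = 1"
    and bi: "\<And>s. s \<in> I \<Longrightarrow> w3 s + frame_curv (u s) (w s) (u s) = 0"
    and ng: "s0 \<in> I" "w s0 \<noteq> 0"
  obtains c A where "c\<^sup>2 < 1" "(2 * A - c)\<^sup>2 = 5 * c\<^sup>2 - 4"
    "\<And>s. s \<in> I \<Longrightarrow> u s $ 3 = c"
    "\<And>s. s \<in> I \<Longrightarrow> ((\<lambda>t. u t $ 1) has_real_derivative - A * u s $ 2) (at s)"
    "\<And>s. s \<in> I \<Longrightarrow> ((\<lambda>t. u t $ 2) has_real_derivative A * u s $ 1) (at s)"
proof -
  have fb: "w s $ 3 = 0"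
    "w2 s \<bullet> w2 s = (w s \<bullet> w s) / 4 - ((u s \<times> w s) $ 3)\<^sup>2"
    "u s \<bullet> w s = 0" "(u s \<times> w s) $ 3 = (u s0 \<times> w s0) $ 3" if "s \<in> I" for s
    using frame_biharmonic_invariants[of I u w w2 w3 s0 s] assms that by blast+
  note du = frame_deriv_self_components[OF d1]
  define c where "c = u s0 $ 3"
  \<comment> \<open>\<open>S\<close> is the squared length of the horizontal part of
    \<open>u\<close>, and \<open>w\<close> will turn out to be \<open>\<beta>\<close> times that
    part turned by a right angle. The connection adds \<open>c\<close> to the rotation
    speed.\<close>
  define S where "S = 1 - c\<^sup>2"
  define b where "b = (u s0 \<times> w s0) $ 3"
  define \<beta> where "\<beta> = b / S"
  define A where "A = \<beta> + c"
  have u3: "u s $ 3 = c" if "s \<in> I" for s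
    unfolding c_def
    by (rule const_if_derivative_0[OF I(2) _ that ng(1)]) (use du(3) fb(1) in fastforce)
  have S: "(u s $ 1)\<^sup>2 + (u s $ 2)\<^sup>2 = S" if "s \<in> I" for s
    using unit[OF that] u3[OF that] by (simp add: S_def inner_3 power2_eq_square)
  \<comment> \<open>Otherwise the curve is vertical, hence a geodesic, against
    \<open>w s0 \<noteq> 0\<close>.\<close>
  have "S \<noteq> 0"
  proof
    assume "S = 0"
    then have u12: "u s $ 1 = 0" "u s $ 2 = 0" if "s \<in> I" for s
      using S[OF that] by (simp_all add: sum_power2_eq_zero_iff)
    have "w s0 $ 1 = 0" "w s0 $ 2 = 0"
      using derivative_of_const_on_open[OF I(1) ng(1) u12(1) du(1)[OF ng(1)]]
        derivative_of_const_on_open[OF I(1) ng(1) u12(2) du(2)[OF ng(1)]] u12 ng(1) by simp_all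
    then show False using fb(1)[OF ng(1)] ng(2) by (simp add: vec_eq_iff forall_3)
  qed
  moreover have "S \<ge> 0" using S[OF ng(1)] by (metis sum_power2_ge_zero)
  ultimately have S0: "S > 0" by simp
  have w: "w s = vector [- \<beta> * u s $ 2, \<beta> * u s $ 1, 0]" if "s \<in> I" for s
  proof -
    \<comment> \<open>Two linear equations for the horizontal components of \<open>w\<close>, with
      determinant \<open>S\<close>.\<close>
    have 1: "u s $ 1 * w s $ 1 + u s $ 2 * w s $ 2 = 0"
      using fb(3)[OF that] fb(1)[OF that] by (simp add: inner_3)
    have 2: "u s $ 1 * w s $ 2 - u s $ 2 * w s $ 1 = b"
      using fb(4)[OF that] unfolding b_def[symmetric] by (simp add: cross3_def)
    have "((u s $ 1)\<^sup>2 + (u s $ 2)\<^sup>2) * w s $ 1 = - b * u s $ 2"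
         "((u s $ 1)\<^sup>2 + (u s $ 2)\<^sup>2) * w s $ 2 = b * u s $ 1"
      using 1 2 by algebra+
    then have "w s $ 1 = - \<beta> * u s $ 2" "w s $ 2 = \<beta> * u s $ 1"
      using S0 S[OF that] by (simp_all add: \<beta>_def field_simps)
    then show ?thesis using fb(1)[OF that] by (simp add: vec_eq_iff forall_3)
  qed
  have d: "((\<lambda>t. u t $ 1) has_real_derivative - A * u s $ 2) (at s)"
      "((\<lambda>t. u t $ 2) has_real_derivative A * u s $ 1) (at s)" if "s \<in> I" for s
    using du(1,2)[OF that] by (simp_all add: w[OF that] u3[OF that] A_def algebra_simps)
  have "\<beta> \<noteq> 0"
    using w[OF ng(1)] ng(2) by (auto simp: vec_eq_iff forall_3)
  \<comment> \<open>Only constants are involved, so it suffices to compute \<open>w2\<close> at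
    \<open>s0\<close> from the explicit \<open>w\<close> and to insert it into the remaining
    relation.\<close>
  have "(2 * A - c)\<^sup>2 = 5 * c\<^sup>2 - 4"
  proof -
    have "((\<lambda>s. vector [- \<beta> * u s $ 2, \<beta> * u s $ 1, 0] :: real^3) has_vector_derivative
       vector [- \<beta> * (A * u s0 $ 1), \<beta> * (- A * u s0 $ 2), 0]) (at s0)"
      by (rule has_vector_derivative_vec3) (auto intro!: derivative_eq_intros d ng)
    then have "(w has_vector_derivative vector [- \<beta> * (A * u s0 $ 1), \<beta> * (- A * u s0 $ 2), 0]) (at s0)"
      by (rule has_vector_derivative_transform_within_open[OF _ I(1) ng(1)]) (simp add: w)
    then have "w2 s0 = vector [- \<beta> * (A * u s0 $ 1), \<beta> * (- A * u s0 $ 2), 0] + frame_conn (u s0) (w s0)"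
      using d2[OF ng(1), unfolded frame_deriv_def] vector_derivative_unique_at
      by (metis diff_eq_eq)
    then have "w2 s0 = vector [- \<beta> * (A - c/2) * u s0 $ 1, - \<beta> * (A - c/2) * u s0 $ 2,
        \<beta> * ((u s0 $ 1)\<^sup>2 + (u s0 $ 2)\<^sup>2) / 2]"
      using u3[OF ng(1)]
      by (simp add: w[OF ng(1)] frame_conn_def cross3_def vec_eq_iff forall_3 power2_eq_square)
        (simp add: field_simps)
    then have "w2 s0 \<bullet> w2 s0 = \<beta>\<^sup>2 * ((A - c/2)\<^sup>2 * ((u s0 $ 1)\<^sup>2 + (u s0 $ 2)\<^sup>2)
        + ((u s0 $ 1)\<^sup>2 + (u s0 $ 2)\<^sup>2)\<^sup>2 / 4)"
      by (simp add: inner_3 power2_eq_square) (simp add: field_simps)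
    also have "\<dots> = \<beta>\<^sup>2 * S * ((A - c/2)\<^sup>2 + S / 4)"
      unfolding S[OF ng(1)] by (simp add: power2_eq_square algebra_simps)
    finally have "w2 s0 \<bullet> w2 s0 = \<beta>\<^sup>2 * S * ((A - c/2)\<^sup>2 + S / 4)" .
    moreover have "w s0 \<bullet> w s0 = \<beta>\<^sup>2 * S"
      by (simp add: w[OF ng(1)] inner_3 S[OF ng(1), symmetric] power2_eq_square algebra_simps)
    moreover have "(u s0 \<times> w s0) $ 3 = \<beta> * S"
      by (simp add: w[OF ng(1)] cross3_def S[OF ng(1), symmetric] power2_eq_square algebra_simps)
    ultimately have "\<beta>\<^sup>2 * S * ((A - c/2)\<^sup>2 + S / 4) = \<beta>\<^sup>2 * S * (1/4 - S)"
      using fb(2)[OF ng(1)] by (simp add: power2_eq_square algebra_simps)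
    then have "(A - c/2)\<^sup>2 + S / 4 = 1/4 - S"
      using \<open>\<beta> \<noteq> 0\<close> S0 by simp
    then show ?thesis by (simp add: S_def power2_eq_square field_simps)
  qed
  with that[of c A] u3 d S0 show ?thesis by (simp add: S_def)
qed

text \<open>Under uniform rotation the second covariant derivative of \<open>w\<close> is a multiple
  of \<open>w\<close>, and so is the curvature term; the equation for \<open>A\<close> makes the two
  cancel.\<close>

lemma helix_imp_frame_biharmonic:
  fixes u :: "real \<Rightarrow> real^3"
  assumes S: "\<And>s. (u s $ 1)\<^sup>2 + (u s $ 2)\<^sup>2 = 1 - c\<^sup>2"
    and A: "(2 * A - c)\<^sup>2 = 5 * c\<^sup>2 - 4"
    and u3: "\<And>s. u s $ 3 = c"
    and d: "\<And>s. ((\<lambda>t. u t $ 1) has_real_derivative - A * u s $ 2) (at s)"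
      "\<And>s. ((\<lambda>t. u t $ 2) has_real_derivative A * u s $ 1) (at s)"
  defines "w \<equiv> \<lambda>s. vector [- (A - c) * u s $ 2, (A - c) * u s $ 1, 0] :: real^3"
  obtains w2 w3 where
    "\<And>s. frame_deriv u u (w s) s"
    "\<And>s. frame_deriv u w (w2 s) s"
    "\<And>s. frame_deriv u w2 (w3 s) s"
    "\<And>s. w3 s + frame_curv (u s) (w s) (u s) = 0"
proof -
  \<comment> \<open>The vector found in the forward direction, with
    \<open>\<beta> = A - c\<close>.\<close>
  define w2 :: "real \<Rightarrow> real^3" where
    "w2 s = vector [- (A - c) * (A - c/2) * u s $ 1, - (A - c) * (A - c/2) * u s $ 2, (A - c) * (1 - c\<^sup>2) / 2]" for s
  define w3 where "w3 s = - ((A - c/2)\<^sup>2 + (1 - c\<^sup>2) / 4) *\<^sub>R w s" for s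
  have u3': "((\<lambda>t. u t $ 3) has_real_derivative 0) (at s)" for s
    by (simp add: u3)
  have "frame_deriv u u (w s) s" for s
    unfolding frame_deriv_def w_def
    by (rule has_vector_derivative_vec3; rule DERIV_cong, rule d u3')
      (simp_all add: frame_conn_def cross3_def u3 algebra_simps)
  moreover have "frame_deriv u w (w2 s) s" for s
    unfolding frame_deriv_def w_def w2_def S[of s, symmetric]
    by (rule has_vector_derivative_vec3)
      (auto intro!: derivative_eq_intros d simp: frame_conn_def cross3_def u3 power2_eq_square field_simps)
  moreover have "frame_deriv u w2 (w3 s) s" for s
    unfolding frame_deriv_def w_def w2_def w3_def
    by (rule has_vector_derivative_vec3)
      (auto intro!: derivative_eq_intros d simp: frame_conn_def cross3_def u3 power2_eq_square field_simps)
  moreover have "w3 s + frame_curv (u s) (w s) (u s) = 0" for s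
  proof -
    have "u s \<bullet> u s = 1" using S[of s] u3[of s] by (simp add: inner_3 power2_eq_square)
    moreover have "w s \<bullet> u s = 0" by (simp add: w_def inner_3 algebra_simps)
    moreover have "(u s \<times> w s) $ 3 = (A - c) * ((u s $ 1)\<^sup>2 + (u s $ 2)\<^sup>2)"
      by (simp add: w_def cross3_def power2_eq_square algebra_simps)
    moreover have "(A - c) *\<^sub>R (axis 3 1 \<times> u s) = w s"
      by (simp add: w_def cross3_def vec_eq_iff forall_3 axis_def algebra_simps)
    ultimately have "frame_curv (u s) (w s) (u s) = (1/4) *\<^sub>R w s - (1 - c\<^sup>2) *\<^sub>R w s"
      unfolding S by (simp add: frame_curv_def) (metis mult.commute scaleR_scaleR)
    \<comment> \<open>The quadratic equation enters here, matching the factor of \<open>w3\<close>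
      with that of the curvature term.\<close>
    moreover have "(A - c/2)\<^sup>2 + (1 - c\<^sup>2) / 4 = 1/4 - (1 - c\<^sup>2)"
      using A by (simp add: power2_eq_square field_simps)
    then have "w3 s = - ((1/4) *\<^sub>R w s - (1 - c\<^sup>2) *\<^sub>R w s)"
      by (simp only: w3_def scaleR_minus_left scaleR_left_diff_distrib)
    ultimately show ?thesis by simp
  qed
  ultimately show ?thesis using that[of w2 w3] by blast
qed

section \<open>Integrating the rotation\<close>

lemma circle_ode:
  fixes p q :: "real \<Rightarrow> real"
  assumes "is_interval I" "s0 \<in> I"
    and d: "\<And>s. s \<in> I \<Longrightarrow> (p has_real_derivative - A * q s) (at s)"
      "\<And>s. s \<in> I \<Longrightarrow> (q has_real_derivative A * p s) (at s)"
    and r: "(p s0)\<^sup>2 + (q s0)\<^sup>2 = r\<^sup>2" "r > 0"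
  obtains a where "\<And>s. s \<in> I \<Longrightarrow> p s = r * cos (A * s + a)" "\<And>s. s \<in> I \<Longrightarrow> q s = r * sin (A * s + a)"
proof -
  \<comment> \<open>Turning \<open>(p, q)\<close> back by the angle \<open>A * s\<close> gives a
    constant vector, whose polar angle is the phase \<open>a\<close>.\<close>
  define P where "P s = p s * cos (A * s) + q s * sin (A * s)" for s
  define Q where "Q s = q s * cos (A * s) - p s * sin (A * s)" for s
  have P: "P s = P s0" if "s \<in> I" for s
    by (rule const_if_derivative_0[OF assms(1) _ that assms(2)])
      (auto simp: P_def[abs_def] algebra_simps intro!: derivative_eq_intros d)
  have Q: "Q s = Q s0" if "s \<in> I" for s
    by (rule const_if_derivative_0[OF assms(1) _ that assms(2)])
      (auto simp: Q_def[abs_def] algebra_simps intro!: derivative_eq_intros d)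
  have pQ: "p s = P s * cos (A * s) - Q s * sin (A * s)"
      "q s = P s * sin (A * s) + Q s * cos (A * s)" for s
    using sin_cos_squared_add[of "A * s"] unfolding P_def Q_def by algebra+
  have "(P s0)\<^sup>2 + (Q s0)\<^sup>2 = r\<^sup>2"
    using sin_cos_squared_add[of "A * s0"] r(1) unfolding P_def Q_def by algebra
  then have "(P s0 / r)\<^sup>2 + (Q s0 / r)\<^sup>2 = 1"
    using r(2) by (simp add: power_divide add_divide_distrib[symmetric])
  then obtain a where a: "P s0 / r = cos a" "Q s0 / r = sin a"
    by (rule sincos_total_2pi)
  then have "P s0 = r * cos a" "Q s0 = r * sin a" using r(2) by (auto simp: field_simps)
  then show ?thesis
    using that[of a] pQ P Q by (simp add: cos_add sin_add algebra_simps)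
qed

section \<open>Helices in the Heisenberg group\<close>

lemma covariant_derivative_frame_deriv:
  assumes "open I" "s \<in> I" "\<And>t. t \<in> I \<Longrightarrow> V t = unframe (\<gamma> t) (f t)"
    and "(\<gamma> has_vector_derivative unframe (\<gamma> s) (u s)) (at s)"
    and "frame_deriv u f f' s"
  shows "covariant_derivative heis_metric \<gamma> V s = unframe (\<gamma> s) f'"
  using covariant_derivative_unframe[OF assms(1-4) assms(5)[unfolded frame_deriv_def]] by simp

lemma bitension_unframe:
  assumes I: "open I" "s \<in> I"
    and g: "\<And>t. t \<in> I \<Longrightarrow> (\<gamma> has_vector_derivative unframe (\<gamma> t) (u t)) (at t)"
    and d1: "\<And>s. s \<in> I \<Longrightarrow> frame_deriv u u (w s) s"
    and d2: "\<And>s. s \<in> I \<Longrightarrow> frame_deriv u w (w2 s) s"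
    and d3: "\<And>s. s \<in> I \<Longrightarrow> frame_deriv u w2 (w3 s) s"
  shows "covariant_derivative heis_metric \<gamma> (velocity \<gamma>) s = unframe (\<gamma> s) (w s)"
    and "bitension heis_metric \<gamma> s = unframe (\<gamma> s) (w3 s + frame_curv (u s) (w s) (u s))"
proof -
  have T: "velocity \<gamma> t = unframe (\<gamma> t) (u t)" if "t \<in> I" for t
    using g[OF that] by (simp add: velocity_def vector_derivative_at)
  \<comment> \<open>Each derivative is computed on all of \<open>I\<close>, so that the next one can
    be taken.\<close>
  have 1: "covariant_derivative heis_metric \<gamma> (velocity \<gamma>) t = unframe (\<gamma> t) (w t)" if "t \<in> I" for t
    by (rule covariant_derivative_frame_deriv[OF I(1) that T g[OF that] d1[OF that]])
  have 2: "covariant_derivative heis_metric \<gamma> (covariant_derivative heis_metric \<gamma> (velocity \<gamma>)) t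
      = unframe (\<gamma> t) (w2 t)" if "t \<in> I" for t
    by (rule covariant_derivative_frame_deriv[OF I(1) that 1 g[OF that] d2[OF that]])
  have 3: "covariant_derivative heis_metric \<gamma> (covariant_derivative heis_metric \<gamma>
      (covariant_derivative heis_metric \<gamma> (velocity \<gamma>))) t = unframe (\<gamma> t) (w3 t)" if "t \<in> I" for t
    by (rule covariant_derivative_frame_deriv[OF I(1) that 2 g[OF that] d3[OF that]])
  show "covariant_derivative heis_metric \<gamma> (velocity \<gamma>) s = unframe (\<gamma> s) (w s)"
    by (rule 1[OF I(2)])
  show "bitension heis_metric \<gamma> s = unframe (\<gamma> s) (w3 s + frame_curv (u s) (w s) (u s))"
    by (simp add: bitension_def Let_def 1 3 T I(2) heis_curvature_unframe unframe_add)
qed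

section \<open>Frame components of a smooth curve\<close>

lemma smooth_curve_frame:
  fixes \<gamma> :: "real \<Rightarrow> real^3"
  assumes "smooth_curve_on I \<gamma>"
  obtains u w w2 w3 where
    "\<And>s. s \<in> I \<Longrightarrow> (\<gamma> has_vector_derivative unframe (\<gamma> s) (u s)) (at s)"
    "\<And>s. s \<in> I \<Longrightarrow> frame_deriv u u (w s) s"
    "\<And>s. s \<in> I \<Longrightarrow> frame_deriv u w (w2 s) s"
    "\<And>s. s \<in> I \<Longrightarrow> frame_deriv u w2 (w3 s) s"
proof -
  define F where "F n = ((\<lambda>f t. vector_derivative f (at t)) ^^ n) \<gamma>" for n
  have F: "(F n has_vector_derivative F (Suc n) s) (at s)" if "s \<in> I" for n s
    using assms that by (simp add: smooth_curve_on_def F_def vector_derivative_works)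
  have F0: "F 0 = \<gamma>" by (simp add: F_def)
  note dF = F[THEN has_real_derivative_nth]
  \<comment> \<open>\<open>\<phi> n\<close> is \<open>heis_form\<close> applied to the n-th
    derivative; \<open>\<psi> n\<close> records how the form changes with its base point.\<close>
  define \<phi> where "\<phi> n s = F n s $ 3 + F 0 s $ 2 / 2 * F n s $ 1 - F 0 s $ 1 / 2 * F n s $ 2" for n s
  define \<psi> where "\<psi> n s = (F 1 s $ 2 * F n s $ 1 - F 1 s $ 1 * F n s $ 2) / 2" for n s
  have d\<phi>: "(\<phi> n has_real_derivative \<phi> (Suc n) s + \<psi> n s) (at s)" if "s \<in> I" for n s
    unfolding \<phi>_def[abs_def] \<psi>_def
    by (auto intro!: derivative_eq_intros dF that simp: field_simps)
  \<comment> \<open>For index 2 the terms with second derivatives of the curve cancel by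
    antisymmetry.\<close>
  have d\<psi>: "(\<psi> 2 has_real_derivative \<psi> 3 s) (at s)" if "s \<in> I" for s
    unfolding \<psi>_def[abs_def]
    by (auto intro!: derivative_eq_intros dF that simp: numeral_2_eq_2 numeral_3_eq_3 field_simps)
  define u :: "real \<Rightarrow> real^3" where "u s = vector [F 1 s $ 1, F 1 s $ 2, \<phi> 1 s]" for s
  define u' :: "real \<Rightarrow> real^3" where "u' s = vector [F 2 s $ 1, F 2 s $ 2, \<phi> 2 s]" for s
  define u'' :: "real \<Rightarrow> real^3" where "u'' s = vector [F 3 s $ 1, F 3 s $ 2, \<phi> 3 s + \<psi> 2 s]" for s
  define u''' :: "real \<Rightarrow> real^3" where
    "u''' s = vector [F 4 s $ 1, F 4 s $ 2, \<phi> 4 s + \<psi> 3 s + \<psi> 3 s]" for s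
  have eqs: "Suc (Suc 0) = 2" "Suc 2 = 3" "Suc 3 = 4" by simp_all
  have \<psi>1: "\<psi> (Suc 0) s = 0" for s by (simp add: \<psi>_def)
  note e = dF[of _ "Suc 0", unfolded eqs] dF[of _ 2, unfolded eqs] dF[of _ 3, unfolded eqs]
    d\<phi>[of _ "Suc 0", unfolded eqs \<psi>1 add_0_right] d\<phi>[of _ 2, unfolded eqs] d\<phi>[of _ 3, unfolded eqs]
  have du: "(u has_vector_derivative u' s) (at s)"
    and du': "(u' has_vector_derivative u'' s) (at s)"
    and du'': "(u'' has_vector_derivative u''' s) (at s)" if "s \<in> I" for s
    unfolding u_def u'_def u''_def u'''_def
    by (rule has_vector_derivative_vec3;
        auto intro!: derivative_eq_intros e[OF that] d\<psi>[OF that])+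
  have conn: "bounded_bilinear frame_conn"
    unfolding bilinear_conv_bounded_bilinear[symmetric] bilinear_def
    by (auto intro!: linearI simp: frame_conn_def cross3_simps forall_3 field_simps)
  note dconn = bounded_bilinear.has_vector_derivative[OF conn]
  \<comment> \<open>Primes denote ordinary derivatives of frame components, while \<open>w\<close>
    and \<open>w2\<close> are covariant ones.\<close>
  define w where "w s = u' s + frame_conn (u s) (u s)" for s
  define w' where "w' s = u'' s + (frame_conn (u s) (u' s) + frame_conn (u' s) (u s))" for s
  define w'' where "w'' s = u''' s + ((frame_conn (u s) (u'' s) + frame_conn (u' s) (u' s))
     + (frame_conn (u' s) (u' s) + frame_conn (u'' s) (u s)))" for s
  have dw: "(w has_vector_derivative w' s) (at s)"
    and dw': "(w' has_vector_derivative w'' s) (at s)" if "s \<in> I" for s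
    unfolding w_def w'_def w''_def
    by (intro has_vector_derivative_add dconn du du' du'' that)+
  define w2 where "w2 s = w' s + frame_conn (u s) (w s)" for s
  define w2' where "w2' s = w'' s + (frame_conn (u s) (w' s) + frame_conn (u' s) (w s))" for s
  have dw2: "(w2 has_vector_derivative w2' s) (at s)" if "s \<in> I" for s
    unfolding w2_def w2'_def
    by (intro has_vector_derivative_add dconn du dw dw' that)
  show ?thesis
  proof
    fix s assume s: "s \<in> I"
    have "unframe (\<gamma> s) (u s) = F 1 s"
      by (simp add: vec_eq_iff forall_3 u_def \<phi>_def F0)
    then show "(\<gamma> has_vector_derivative unframe (\<gamma> s) (u s)) (at s)"
      using F[OF s, of 0] by (simp add: F0)
    show "frame_deriv u u (w s) s" using du[OF s] by (simp add: frame_deriv_def w_def)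
    show "frame_deriv u w (w2 s) s" using dw[OF s] by (simp add: frame_deriv_def w2_def)
    show "frame_deriv u w2 (w2' s + frame_conn (u s) (w2 s)) s"
      using dw2[OF s] by (simp add: frame_deriv_def)
  qed
qed

section \<open>The parametrised helices\<close>

definition heis_helix :: "real set \<Rightarrow> (real \<Rightarrow> real^3) \<Rightarrow> real \<Rightarrow> real \<Rightarrow> real \<Rightarrow> real \<Rightarrow> real \<Rightarrow> real \<Rightarrow> bool"
  where "heis_helix I \<gamma> \<alpha> A a b c d \<longleftrightarrow> (\<forall>s\<in>I.
       \<gamma> s $ 1 = 1 / A * sin \<alpha> * sin (A * s + a) + b \<and>
       \<gamma> s $ 2 = - (1 / A) * sin \<alpha> * cos (A * s + a) + c \<and>
       \<gamma> s $ 3 = (cos \<alpha> + (sin \<alpha>)\<^sup>2 / (2 * A)) * s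
                  - b / (2 * A) * sin \<alpha> * cos (A * s + a)
                  - c / (2 * A) * sin \<alpha> * sin (A * s + a) + d)"

text \<open>These are frame components, so \<open>\<alpha>\<close> is the constant angle with
  \<open>e\<^sub>3\<close>.\<close>

definition helix_velocity :: "real \<Rightarrow> real \<Rightarrow> real \<Rightarrow> real \<Rightarrow> real^3"
  where "helix_velocity \<alpha> A a s = vector [sin \<alpha> * cos (A * s + a), sin \<alpha> * sin (A * s + a), cos \<alpha>]"

lemma heis_helix_velocity:
  assumes "open I" "s \<in> I" "A \<noteq> 0" "heis_helix I \<gamma> \<alpha> A a b c d"
  shows "(\<gamma> has_vector_derivative unframe (\<gamma> s) (helix_velocity \<alpha> A a s)) (at s)"
proof -
  let ?h = "\<lambda>s. vector [1 / A * sin \<alpha> * sin (A * s + a) + b,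
     - (1 / A) * sin \<alpha> * cos (A * s + a) + c,
     (cos \<alpha> + (sin \<alpha>)\<^sup>2 / (2 * A)) * s
       - b / (2 * A) * sin \<alpha> * cos (A * s + a)
       - c / (2 * A) * sin \<alpha> * sin (A * s + a) + d] :: real^3"
  have eq: "\<gamma> t = ?h t" if "t \<in> I" for t
    using assms(4) that unfolding heis_helix_def by (simp add: vec_eq_iff forall_3)
  \<comment> \<open>The oscillating parts of the first two coordinates enter the third equation
    quadratically and sum to the slope \<open>(sin \<alpha>)\<^sup>2 / (2 * A)\<close>.\<close>
  have sq: "(cos (a + A * s))\<^sup>2 + (sin (a + A * s))\<^sup>2 = 1"
      by simp
  have "(?h has_vector_derivative unframe (\<gamma> s) (helix_velocity \<alpha> A a s)) (at s)"
    unfolding eq[OF assms(2)]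
  proof (rule has_vector_derivative_vec3)
    show "((\<lambda>t. ?h t $ 3) has_real_derivative unframe (?h s) (helix_velocity \<alpha> A a s) $ 3) (at s)"
      using assms(3)
      by (auto intro!: derivative_eq_intros simp: helix_velocity_def power2_eq_square field_simps)
        (use sq in algebra)
  qed (use assms(3) in \<open>auto intro!: derivative_eq_intros simp: helix_velocity_def\<close>)
  then show ?thesis
    by (rule has_vector_derivative_transform_within_open[OF _ assms(1,2)]) (simp add: eq)
qed

lemma heis_helix_biharmonic:
  assumes I: "open I" "I \<noteq> {}"
    and A: "(2 * A - cos \<alpha>)\<^sup>2 = 5 * (cos \<alpha>)\<^sup>2 - 4" and \<alpha>: "sin \<alpha> \<noteq> 0"
    and helix: "heis_helix I \<gamma> \<alpha> A a b c d"
  shows "biharmonic_on heis_metric I \<gamma>" "\<not> geodesic_on heis_metric I \<gamma>"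
proof -
  \<comment> \<open>The factored quadratic gives both \<open>A \<noteq> 0\<close>, so that the
    divisions are genuine, and \<open>A - cos \<alpha> \<noteq> 0\<close>, so that the curve is not
    a geodesic.\<close>
  have AA: "A * (A - cos \<alpha>) = - (sin \<alpha>)\<^sup>2"
    using A sin_cos_squared_add[of \<alpha>] by algebra
  then have A0: "A \<noteq> 0" "A - cos \<alpha> \<noteq> 0" using \<alpha> by auto
  define u where "u = helix_velocity \<alpha> A a"
  have g: "(\<gamma> has_vector_derivative unframe (\<gamma> s) (u s)) (at s)" if "s \<in> I" for s
    unfolding u_def by (rule heis_helix_velocity[OF I(1) that A0(1) helix])
  have u2: "(u s $ 1)\<^sup>2 + (u s $ 2)\<^sup>2 = (sin \<alpha>)\<^sup>2" for s
    using sin_cos_squared_add[of "A * s + a"]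
    by (simp add: u_def helix_velocity_def power_mult_distrib flip: distrib_left)
  have *: "(u s $ 1)\<^sup>2 + (u s $ 2)\<^sup>2 = 1 - (cos \<alpha>)\<^sup>2" "u s $ 3 = cos \<alpha>"
      "((\<lambda>t. u t $ 1) has_real_derivative - A * u s $ 2) (at s)"
      "((\<lambda>t. u t $ 2) has_real_derivative A * u s $ 1) (at s)" for s
    using u2[of s] sin_squared_eq[of \<alpha>]
    by (auto simp: u_def helix_velocity_def intro!: derivative_eq_intros)
  obtain w2 w3 where fr:
    "\<And>s. frame_deriv u u (vector [- (A - cos \<alpha>) * u s $ 2, (A - cos \<alpha>) * u s $ 1, 0]) s"
    "\<And>s. frame_deriv u (\<lambda>s. vector [- (A - cos \<alpha>) * u s $ 2, (A - cos \<alpha>) * u s $ 1, 0]) (w2 s) s"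
    "\<And>s. frame_deriv u w2 (w3 s) s"
    "\<And>s. w3 s + frame_curv (u s) (vector [- (A - cos \<alpha>) * u s $ 2, (A - cos \<alpha>) * u s $ 1, 0]) (u s) = 0"
    using helix_imp_frame_biharmonic[OF *(1) A *(2,3,4)] by blast
  note bt = bitension_unframe[OF I(1) _ g fr(1,2,3)]
  show "biharmonic_on heis_metric I \<gamma>"
    unfolding biharmonic_on_def using bt(2) fr(4) by (metis unframe_eq_0_iff)
  \<comment> \<open>On an empty interval every curve would be a geodesic.\<close>
  obtain s where s: "s \<in> I" using I(2) by blast
  have "vector [- (A - cos \<alpha>) * u s $ 2, (A - cos \<alpha>) * u s $ 1, 0] \<noteq> (0 :: real^3)"
    using u2[of s] \<alpha> A0(2) by (auto simp: vec_eq_iff forall_3)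
  then show "\<not> geodesic_on heis_metric I \<gamma>"
    unfolding geodesic_on_def using bt(1)[OF s] s by (metis unframe_eq_0_iff)
qed

lemma heis_helix_if_velocity:
  assumes "is_interval I" "A \<noteq> 0"
    and g: "\<And>s. s \<in> I \<Longrightarrow> (\<gamma> has_vector_derivative unframe (\<gamma> s) (helix_velocity \<alpha> A a s)) (at s)"
  obtains b c d where "heis_helix I \<gamma> \<alpha> A a b c d"
proof (cases "I = {}")
  case True
  then show ?thesis using that by (simp add: heis_helix_def)
next
  case False
  then obtain s0 where s0: "s0 \<in> I" by blast
  note dg = g[THEN has_real_derivative_nth]
  \<comment> \<open>\<open>X\<close> and \<open>Y\<close> isolate the integration constants
    \<open>b\<close> and \<open>c\<close>, which must be known before the third coordinate, whose
    derivative involves the first two.\<close>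
  define X where "X s = \<gamma> s $ 1 - 1 / A * sin \<alpha> * sin (A * s + a)" for s
  define Y where "Y s = \<gamma> s $ 2 + 1 / A * sin \<alpha> * cos (A * s + a)" for s
  have X: "X s = X s0" if "s \<in> I" for s
    by (rule const_if_derivative_0[OF assms(1) _ that s0])
      (use assms(2) in \<open>auto simp: X_def[abs_def] helix_velocity_def intro!: derivative_eq_intros dg\<close>)
  have Y: "Y s = Y s0" if "s \<in> I" for s
    by (rule const_if_derivative_0[OF assms(1) _ that s0])
      (use assms(2) in \<open>auto simp: Y_def[abs_def] helix_velocity_def intro!: derivative_eq_intros dg\<close>)
  define b where "b = X s0"
  define c where "c = Y s0"
  have x: "\<gamma> s $ 1 = 1 / A * sin \<alpha> * sin (A * s + a) + b"
    and y: "\<gamma> s $ 2 = - (1 / A) * sin \<alpha> * cos (A * s + a) + c" if "s \<in> I" for s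
    using X[OF that] Y[OF that] by (simp_all add: X_def Y_def b_def c_def)
  define Z where "Z s = \<gamma> s $ 3 - ((cos \<alpha> + (sin \<alpha>)\<^sup>2 / (2 * A)) * s
                  - b / (2 * A) * sin \<alpha> * cos (A * s + a)
                  - c / (2 * A) * sin \<alpha> * sin (A * s + a))" for s
  have Z: "Z s = Z s0" if "s \<in> I" for s
  proof (rule const_if_derivative_0[OF assms(1) _ that s0])
    fix s assume s: "s \<in> I"
    have sq: "(cos (a + A * s))\<^sup>2 + (sin (a + A * s))\<^sup>2 = 1"
      by simp
    show "(Z has_real_derivative 0) (at s)"
      unfolding Z_def[abs_def] using assms(2)
      by (auto intro!: derivative_eq_intros dg s simp: helix_velocity_def x[OF s] y[OF s]
          power2_eq_square field_simps)
        (use sq in algebra)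
  qed
  have z: "\<gamma> s $ 3 = (cos \<alpha> + (sin \<alpha>)\<^sup>2 / (2 * A)) * s
      - b / (2 * A) * sin \<alpha> * cos (A * s + a) - c / (2 * A) * sin \<alpha> * sin (A * s + a) + Z s0"
    if "s \<in> I" for s
    using Z[OF that] unfolding Z_def[of s] by linarith
  have "heis_helix I \<gamma> \<alpha> A a b c (Z s0)"
    unfolding heis_helix_def using x y z by blast
  then show ?thesis using that by blast
qed

lemma biharmonic_imp_heis_helix:
  assumes I: "open I" "is_interval I"
    and \<gamma>: "smooth_curve_on I \<gamma>" "arc_length_on heis_metric I \<gamma>"
    and bi: "biharmonic_on heis_metric I \<gamma>" "\<not> geodesic_on heis_metric I \<gamma>"
  obtains \<alpha> A a b c d where "0 < \<alpha>" "\<alpha> < pi" "(2 * A - cos \<alpha>)\<^sup>2 = 5 * (cos \<alpha>)\<^sup>2 - 4"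
    "heis_helix I \<gamma> \<alpha> A a b c d"
proof -
  obtain u w w2 w3 where g: "\<And>s. s \<in> I \<Longrightarrow> (\<gamma> has_vector_derivative unframe (\<gamma> s) (u s)) (at s)"
    and fr: "\<And>s. s \<in> I \<Longrightarrow> frame_deriv u u (w s) s"
      "\<And>s. s \<in> I \<Longrightarrow> frame_deriv u w (w2 s) s"
      "\<And>s. s \<in> I \<Longrightarrow> frame_deriv u w2 (w3 s) s"
    using smooth_curve_frame[OF \<gamma>(1)] by blast
  have bt: "covariant_derivative heis_metric \<gamma> (velocity \<gamma>) s = unframe (\<gamma> s) (w s)"
    "bitension heis_metric \<gamma> s = unframe (\<gamma> s) (w3 s + frame_curv (u s) (w s) (u s))" if "s \<in> I" for s
    using bitension_unframe[of I s \<gamma> u w w2 w3] I(1) that g fr by blast+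
  have bi': "w3 s + frame_curv (u s) (w s) (u s) = 0" if "s \<in> I" for s
    using bi(1) bt(2)[OF that] that by (simp add: biharmonic_on_def)
  have unit: "u s \<bullet> u s = 1" if "s \<in> I" for s
  proof -
    have "velocity \<gamma> s = unframe (\<gamma> s) (u s)"
      using g[OF that] by (simp add: velocity_def vector_derivative_at)
    moreover have "sqrt (heis_metric (\<gamma> s) (velocity \<gamma> s) (velocity \<gamma> s)) = 1"
      using \<gamma>(2) that unfolding arc_length_on_def by blast
    ultimately show ?thesis by simp
  qed
  obtain s0 where s0: "s0 \<in> I" "w s0 \<noteq> 0"
    using bi(2) bt(1) by (auto simp: geodesic_on_def)
  obtain c A where c: "c\<^sup>2 < 1" "(2 * A - c)\<^sup>2 = 5 * c\<^sup>2 - 4"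
    "\<And>s. s \<in> I \<Longrightarrow> u s $ 3 = c"
    "\<And>s. s \<in> I \<Longrightarrow> ((\<lambda>t. u t $ 1) has_real_derivative - A * u s $ 2) (at s)"
    "\<And>s. s \<in> I \<Longrightarrow> ((\<lambda>t. u t $ 2) has_real_derivative A * u s $ 1) (at s)"
    using frame_biharmonic_imp_helix[of I u w w2 w3 s0] I fr unit bi' s0 by blast
  define \<alpha> where "\<alpha> = arccos c"
  have "\<bar>c\<bar> < 1" using c(1) by (simp add: abs_square_less_1)
  then have \<alpha>: "0 < \<alpha>" "\<alpha> < pi" "cos \<alpha> = c"
    using arccos_lt_bounded[of c] by (auto simp: \<alpha>_def)
  \<comment> \<open>For \<open>A = 0\<close> the quadratic equation would give
    \<open>c\<^sup>2 = 1\<close>.\<close>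
  have "A \<noteq> 0" using c(1,2) by auto
  have "(u s0 $ 1)\<^sup>2 + (u s0 $ 2)\<^sup>2 = (sin \<alpha>)\<^sup>2"
    using unit[OF s0(1)] c(3)[OF s0(1)] sin_cos_squared_add[of \<alpha>]
    by (simp add: \<alpha>(3) inner_3 power2_eq_square)
  moreover have "sin \<alpha> > 0" using \<alpha> by (simp add: sin_gt_zero)
  ultimately obtain a where "\<And>s. s \<in> I \<Longrightarrow> u s $ 1 = sin \<alpha> * cos (A * s + a)"
    "\<And>s. s \<in> I \<Longrightarrow> u s $ 2 = sin \<alpha> * sin (A * s + a)"
    using circle_ode[OF I(2) s0(1) c(4,5)] by blast
  then have "u s = helix_velocity \<alpha> A a s" if "s \<in> I" for s
    using that c(3) \<alpha>(3) by (simp add: helix_velocity_def vec_eq_iff forall_3)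
  then obtain b k d where "heis_helix I \<gamma> \<alpha> A a b k d"
    using heis_helix_if_velocity[OF I(2) \<open>A \<noteq> 0\<close>, of \<gamma> \<alpha> a] g by metis
  then show ?thesis using that[of \<alpha> A] \<alpha> c(2) by blast
qed

section \<open>Admissible angles and the choice of sign\<close>

lemma helix_parameters_iff:
  "0 < \<alpha> \<and> \<alpha> < pi \<and> (2 * A - cos \<alpha>)\<^sup>2 = 5 * (cos \<alpha>)\<^sup>2 - 4 \<longleftrightarrow>
    \<alpha> \<in> {0<..arccos (2 * sqrt 5 / 5)} \<union> {arccos (- (2 * sqrt 5 / 5))..<pi} \<and>
    A \<in> {(cos \<alpha> + sqrt (5 * (cos \<alpha>)\<^sup>2 - 4)) / 2, (cos \<alpha> - sqrt (5 * (cos \<alpha>)\<^sup>2 - 4)) / 2}"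
proof -
  \<comment> \<open>The discriminant \<open>5 * (cos \<alpha>)\<^sup>2 - 4\<close> is nonnegative
    exactly when \<open>\<bar>cos \<alpha>\<bar>\<close> is at least \<open>q\<close>.\<close>
  define q :: real where "q = 2 * sqrt 5 / 5"
  have q2: "q\<^sup>2 = 4 / 5" by (simp add: q_def power_mult_distrib power_divide)
  have "q \<le> 1" by (rule power2_le_imp_le) (simp_all add: q2)
  moreover have "0 < q" by (simp add: q_def)
  ultimately have q: "0 < q" "q \<le> 1" "- 1 < q" by linarith+
  \<comment> \<open>Thus each of the two intervals lies inside the open interval from 0 to
    \<open>pi\<close>.\<close>
  have arc: "arccos q < pi" "0 < arccos (- q)"
    using q arccos_less_arccos[of "-1" q] arccos_less_arccos[of "- q" 1] by simp_all
  have range: "0 < \<alpha> \<and> \<alpha> < pi \<and> 4 \<le> 5 * (cos \<alpha>)\<^sup>2 \<longleftrightarrow>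
      \<alpha> \<in> {0<..arccos q} \<union> {arccos (- q)..<pi}"
  proof (cases "0 \<le> \<alpha> \<and> \<alpha> \<le> pi")
    case True
    have le: "\<alpha> \<le> arccos x \<longleftrightarrow> x \<le> cos \<alpha>" "arccos x \<le> \<alpha> \<longleftrightarrow> cos \<alpha> \<le> x" if "-1 \<le> x" "x \<le> 1" for x
      using that True cos_mono_le_eq[of "arccos x" \<alpha>] cos_mono_le_eq[of \<alpha> "arccos x"]
        arccos_lbound[of x] arccos_ubound[of x] by simp_all
    have "4 \<le> 5 * (cos \<alpha>)\<^sup>2 \<longleftrightarrow> q\<^sup>2 \<le> (cos \<alpha>)\<^sup>2" unfolding q2 by auto
    also have "\<dots> \<longleftrightarrow> q \<le> \<bar>cos \<alpha>\<bar>" using q(1) by (metis abs_le_square_iff abs_of_pos)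
    also have "\<dots> \<longleftrightarrow> \<alpha> \<le> arccos q \<or> arccos (- q) \<le> \<alpha>"
      using q by (auto simp: le)
    finally show ?thesis using arc by auto
  qed (use arc in auto)
  \<comment> \<open>As \<open>sqrt\<close> is total, \<open>0 \<le> D\<close> is kept explicit; for
    the discriminant it is the range condition on \<open>\<alpha>\<close>.\<close>
  have sqr: "x\<^sup>2 = D \<longleftrightarrow> 0 \<le> D \<and> (x = sqrt D \<or> x = - sqrt D)" for x D :: real
    by (metis power2_eq_iff real_sqrt_pow2 zero_le_power2)
  show ?thesis
    unfolding q_def[symmetric] range[symmetric] sqr by (auto simp: field_simps)
qed

theorem theorem5p2:
  fixes I :: "real set" and \<gamma> :: "real \<Rightarrow> real^3"
  assumes "open I" and "is_interval I" and "I \<noteq> {}"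
    and "smooth_curve_on I \<gamma>"
    and "arc_length_on heis_metric I \<gamma>"
  shows "biharmonic_on heis_metric I \<gamma> \<and> \<not> geodesic_on heis_metric I \<gamma> \<longleftrightarrow>
    (\<exists>\<alpha>\<^sub>0 \<in> {0<..arccos (2 * sqrt 5 / 5)} \<union> {arccos (- (2 * sqrt 5 / 5))..<pi}.
     \<exists>A \<in> {(cos \<alpha>\<^sub>0 + sqrt (5 * (cos \<alpha>\<^sub>0)\<^sup>2 - 4)) / 2, (cos \<alpha>\<^sub>0 - sqrt (5 * (cos \<alpha>\<^sub>0)\<^sup>2 - 4)) / 2}.
     \<exists>a b c d. \<forall>s\<in>I.
       \<gamma> s $ 1 = 1 / A * sin \<alpha>\<^sub>0 * sin (A * s + a) + b \<and>
       \<gamma> s $ 2 = - (1 / A) * sin \<alpha>\<^sub>0 * cos (A * s + a) + c \<and>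
       \<gamma> s $ 3 = (cos \<alpha>\<^sub>0 + (sin \<alpha>\<^sub>0)\<^sup>2 / (2 * A)) * s
                  - b / (2 * A) * sin \<alpha>\<^sub>0 * cos (A * s + a)
                  - c / (2 * A) * sin \<alpha>\<^sub>0 * sin (A * s + a) + d)"
  unfolding heis_helix_def[symmetric]
proof
  assume "biharmonic_on heis_metric I \<gamma> \<and> \<not> geodesic_on heis_metric I \<gamma>"
  then obtain \<alpha> A a b c d where
    "0 < \<alpha>" "\<alpha> < pi" "(2 * A - cos \<alpha>)\<^sup>2 = 5 * (cos \<alpha>)\<^sup>2 - 4" "heis_helix I \<gamma> \<alpha> A a b c d"
    using biharmonic_imp_heis_helix[OF assms(1,2,4,5)] by blast
  then show "\<exists>\<alpha>\<^sub>0 \<in> {0<..arccos (2 * sqrt 5 / 5)} \<union> {arccos (- (2 * sqrt 5 / 5))..<pi}.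
     \<exists>A \<in> {(cos \<alpha>\<^sub>0 + sqrt (5 * (cos \<alpha>\<^sub>0)\<^sup>2 - 4)) / 2, (cos \<alpha>\<^sub>0 - sqrt (5 * (cos \<alpha>\<^sub>0)\<^sup>2 - 4)) / 2}.
     \<exists>a b c d. heis_helix I \<gamma> \<alpha>\<^sub>0 A a b c d"
    using helix_parameters_iff[of \<alpha> A] by meson
next
  assume "\<exists>\<alpha>\<^sub>0 \<in> {0<..arccos (2 * sqrt 5 / 5)} \<union> {arccos (- (2 * sqrt 5 / 5))..<pi}.
     \<exists>A \<in> {(cos \<alpha>\<^sub>0 + sqrt (5 * (cos \<alpha>\<^sub>0)\<^sup>2 - 4)) / 2, (cos \<alpha>\<^sub>0 - sqrt (5 * (cos \<alpha>\<^sub>0)\<^sup>2 - 4)) / 2}.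
     \<exists>a b c d. heis_helix I \<gamma> \<alpha>\<^sub>0 A a b c d"
  then obtain \<alpha> A a b c d where
    \<alpha>: "\<alpha> \<in> {0<..arccos (2 * sqrt 5 / 5)} \<union> {arccos (- (2 * sqrt 5 / 5))..<pi}"
    and A: "A \<in> {(cos \<alpha> + sqrt (5 * (cos \<alpha>)\<^sup>2 - 4)) / 2, (cos \<alpha> - sqrt (5 * (cos \<alpha>)\<^sup>2 - 4)) / 2}"
    and helix: "heis_helix I \<gamma> \<alpha> A a b c d"
    by blast
  then have p: "0 < \<alpha>" "\<alpha> < pi" "(2 * A - cos \<alpha>)\<^sup>2 = 5 * (cos \<alpha>)\<^sup>2 - 4"
    using helix_parameters_iff[of \<alpha> A] by blast+
  then have "sin \<alpha> \<noteq> 0" using sin_gt_zero by fastforce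
  then show "biharmonic_on heis_metric I \<gamma> \<and> \<not> geodesic_on heis_metric I \<gamma>"
    using heis_helix_biharmonic[OF assms(1,3) p(3) _ helix] by blast
qed

end
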